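(* Let $S$ be a semigroup and let $\sigma:S\to S$ be an automorphism (not necessarily involutive). The functional equations $$g(x\sigma(y))=g(x)g(y)+f(x)f(y),\quad x,y\in S,$$ and $$g(\sigma(y)x)=g(x)g(y)+f(x)f(y),\quad x,y\in S,$$ for unknown functions $f,g:S\to\mathbb{C}$, have the same solutions $(g,f)$.
   Context: A semigroup is a set with an associative binary operation. An automorphism $\sigma:S\to S$ is a bijection with $\sigma(xy)=\sigma(x)\sigma(y)$ for all $x,y\in S$. *)

theory Defs
  imports Complex_Main
begin

definition semigroup_automorphism :: "('a::semigroup_mult \<Rightarrow> 'a) \<Rightarrow> bool" where
  "semigroup_automorphism \<sigma> \<longleftrightarrow> bij \<sigma> \<and> (\<forall>x y. \<sigma> (x * y) = \<sigma> x * \<sigma> y)"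

end

theory Submission
  imports Defs
begin

text \<open>
  The right-hand sides agree, so it is enough that in a solution of either equation \<open>g\<close> is central:
  \<open>g (x * y) = g (y * x)\<close> for all \<open>x\<close>, \<open>y\<close>. The second equation for \<open>S\<close> is the first one for the opposite semigroup, so it suffices to
  treat the first equation over an arbitrary semigroup operation.

  The case \<open>g = 0\<close> is trivial. If \<open>f\<close> is a multiple of \<open>g\<close>, the equation reads
  \<open>g (x * \<sigma> y) = k * g x * g y\<close>. For \<open>k = 0\<close>, surjectivity of \<open>\<sigma>\<close> shows that \<open>g\<close> vanishes on all
  products; for \<open>k \<noteq> 0\<close>, comparing the two bracketings of \<open>x * \<sigma> y * \<sigma> z\<close> gives
  \<open>g (y * z) = k * g y * g z\<close>, which is symmetric.

  Otherwise the vectors \<open>v x = (g x, f x)\<close> span the plane. Associativity makes left multiplication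
  by \<open>x\<close> act on them through a matrix \<open>M x\<close> with first column \<open>v x\<close>, and right multiplication by
  \<open>\<sigma> y\<close> act through the transpose of \<open>M y\<close>. As left and right multiplications commute, \<open>M x\<close>
  commutes with the transpose of \<open>M y\<close>. The upper left entries of the two products give
  \<open>p x * p y = f x * f y\<close>, where \<open>p x\<close> is the upper right entry of \<open>M x\<close>; hence \<open>p = f\<close> or \<open>p = - f\<close>, and
  \<open>g (x * y) = g x * g y + p x * f y\<close> is symmetric.
\<close>

section \<open>Linear independence of two functions\<close>

lemma proportional_or_determinant:
  fixes f g :: "'a \<Rightarrow> 'b::field"
  assumes "g a \<noteq> 0"
  obtains c where "\<And>x. f x = c * g x"
    | b where "g a * f b - f a * g b \<noteq> 0"
proof (cases "\<exists>b. g a * f b - f a * g b \<noteq> 0")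
  case True
  then show ?thesis using that(2) by blast
next
  case False
  then have "\<And>x. f x = (f a / g a) * g x"
    using assms by (simp add: field_simps)
  then show ?thesis using that(1) by blast
qed

text \<open>Cramer's rule for a homogeneous system, with the linear form evaluated at \<open>a\<close> and \<open>b\<close>.\<close>

lemma linear_form_eq_0:
  fixes f g :: "'a \<Rightarrow> 'b::field"
  assumes det: "g a * f b - f a * g b \<noteq> 0"
    and eq: "\<And>z. s * g z + t * f z = 0"
  shows "s = 0" "t = 0"
proof -
  have "s * (g a * f b - f a * g b) = (s * g a + t * f a) * f b - (s * g b + t * f b) * f a"
    by (simp add: algebra_simps)
  then show "s = 0" using det eq by simp
  have "t * (g a * f b - f a * g b) = (s * g b + t * f b) * g a - (s * g a + t * f a) * g b"
    by (simp add: algebra_simps)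
  then show "t = 0" using det eq by simp
qed

text \<open>A rank-one symmetric form determines its linear factor up to sign; only the symmetry that
  this forces is recorded, so that no sign has to be carried along.\<close>

lemma mult_commute_if_same_products:
  fixes f p :: "'a \<Rightarrow> 'b::field"
  assumes eq: "\<And>x y. p x * p y = f x * f y"
  shows "p x * f y = p y * f x"
proof (cases "p x = 0 \<and> p y = 0")
  case True
  then show ?thesis by simp
next
  case False
  have "p x * (p x * f y) = p x * (p y * f x)" "p y * (p x * f y) = p y * (p y * f x)"
    using eq by (metis mult.assoc mult.commute)+
  then show ?thesis using False by auto
qed

section \<open>Solutions of the first equation are central\<close>

text \<open>Surjectivity of \<open>\<sigma>\<close> settles \<open>k = 0\<close>. For \<open>k \<noteq> 0\<close>, evaluating \<open>g\<close> at the product of \<open>x\<close>, \<open>\<sigma> y\<close>, \<open>\<sigma> z\<close> gives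
  \<open>k\<^sup>2 * g x * g y * g z\<close> by grouping the first two factors, and \<open>k * g x * g (y \<cdot> z)\<close> by grouping the
  last two.\<close>

lemma central_if_proportional:
  fixes m :: "'a \<Rightarrow> 'a \<Rightarrow> 'a" (infixl \<open>\<cdot>\<close> 70)
    and g :: "'a \<Rightarrow> 'b::field"
  assumes "semigroup m"
    and hom: "\<And>x y. \<sigma> (x \<cdot> y) = \<sigma> x \<cdot> \<sigma> y" and "surj \<sigma>"
    and eq: "\<And>x y. g (x \<cdot> \<sigma> y) = k * g x * g y"
  shows "g (x \<cdot> y) = g (y \<cdot> x)"
proof (cases "k = 0 \<or> (\<forall>a. g a = 0)")
  case True
  then have "g (u \<cdot> \<sigma> w) = 0" for u w using eq by auto
  then have "g (u \<cdot> w) = 0" for u w using \<open>surj \<sigma>\<close> by (metis surjD)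
  then show ?thesis by simp
next
  case False
  then obtain a where a: "k \<noteq> 0" "g a \<noteq> 0" by blast
  have "g (y \<cdot> z) = k * g y * g z" for y z
  proof -
    have "k * g a * g (y \<cdot> z) = g (a \<cdot> \<sigma> y \<cdot> \<sigma> z)"
      using eq[of a "y \<cdot> z"] by (simp add: hom semigroup.assoc[OF \<open>semigroup m\<close>])
    also have "\<dots> = k * g a * (k * g y * g z)" by (simp add: eq)
    finally show ?thesis using a by simp
  qed
  then show ?thesis by (simp add: mult.commute mult.left_commute)
qed

text \<open>The functions \<open>p\<close> and \<open>q\<close> form the second column of the matrix through which left multiplication
  acts on \<open>(g, f)\<close>; the last equation is the second row of the transposed action of right
  multiplication, whose first row is the functional equation itself.

  The first two follow from the two bracketings of the product of \<open>x\<close>, \<open>\<sigma> y\<close>, \<open>\<sigma> z\<close>: for \<open>x = a\<close> and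
  \<open>x = b\<close> they give a regular linear system for \<open>g (y \<cdot> z)\<close> and \<open>f (y \<cdot> z)\<close>, which Cramer's rule
  solves. Substituting the solution back and cancelling a nonzero value of \<open>f\<close> gives the third.\<close>

lemma addition_law_matrix:
  fixes m :: "'a \<Rightarrow> 'a \<Rightarrow> 'a" (infixl \<open>\<cdot>\<close> 70)
    and f g :: "'a \<Rightarrow> 'b::field"
  assumes "semigroup m"
    and hom: "\<And>x y. \<sigma> (x \<cdot> y) = \<sigma> x \<cdot> \<sigma> y"
    and eq: "\<And>x y. g (x \<cdot> \<sigma> y) = g x * g y + f x * f y"
    and det: "g a * f b - f a * g b \<noteq> 0"
  obtains p q where "\<And>y z. g (y \<cdot> z) = g y * g z + p y * f z"
    and "\<And>y z. f (y \<cdot> z) = f y * g z + q y * f z"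
    and "\<And>x y. f (x \<cdot> \<sigma> y) = p y * g x + q y * f x"
proof -
  define D where "D = g a * f b - f a * g b"
  define p where "p y = (f (a \<cdot> \<sigma> y) * f b - f (b \<cdot> \<sigma> y) * f a) / D" for y
  define q where "q y = (f (b \<cdot> \<sigma> y) * g a - f (a \<cdot> \<sigma> y) * g b) / D" for y
  have D: "D \<noteq> 0" using det by (simp add: D_def)
  have key: "g x * (g (y \<cdot> z) - g y * g z) + f x * (f (y \<cdot> z) - f y * g z) = f (x \<cdot> \<sigma> y) * f z"
    for x y z
  proof -
    have "g x * g (y \<cdot> z) + f x * f (y \<cdot> z) = g (x \<cdot> \<sigma> y \<cdot> \<sigma> z)"
      using eq[of x "y \<cdot> z"] by (simp add: hom semigroup.assoc[OF \<open>semigroup m\<close>])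
    also have "\<dots> = (g x * g y + f x * f y) * g z + f (x \<cdot> \<sigma> y) * f z" by (simp add: eq)
    finally show ?thesis by (simp add: algebra_simps)
  qed
  have g_mult: "g (y \<cdot> z) - g y * g z = p y * f z" for y z
  proof -
    have "D * (g (y \<cdot> z) - g y * g z)
        = (f (a \<cdot> \<sigma> y) * f z) * f b - (f (b \<cdot> \<sigma> y) * f z) * f a"
      unfolding key[symmetric] D_def by (simp add: algebra_simps)
    then show ?thesis using D by (simp add: p_def field_simps)
  qed
  have f_mult: "f (y \<cdot> z) - f y * g z = q y * f z" for y z
  proof -
    have "D * (f (y \<cdot> z) - f y * g z)
        = (f (b \<cdot> \<sigma> y) * f z) * g a - (f (a \<cdot> \<sigma> y) * f z) * g b"
      unfolding key[symmetric] D_def by (simp add: algebra_simps)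
    then show ?thesis using D by (simp add: q_def field_simps)
  qed
  obtain c where c: "f c \<noteq> 0" using det by fastforce
  have "f (x \<cdot> \<sigma> y) = p y * g x + q y * f x" for x y
  proof -
    have "f (x \<cdot> \<sigma> y) * f c = (p y * g x + q y * f x) * f c"
      unfolding key[symmetric] g_mult f_mult by (simp add: algebra_simps)
    then show ?thesis using c by simp
  qed
  moreover have "g (y \<cdot> z) = g y * g z + p y * f z" "f (y \<cdot> z) = f y * g z + q y * f z" for y z
    using g_mult[of y z] f_mult[of y z] by (simp_all add: algebra_simps)
  ultimately show ?thesis using that by blast
qed

text \<open>Here \<open>x \<cdot> (z \<cdot> \<sigma> y) = (x \<cdot> z) \<cdot> \<sigma> y\<close> says that left and right multiplications commute; comparing the
  coefficients of \<open>g z\<close> yields \<open>p x * p y = f x * f y\<close>.\<close>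

lemma central_if_independent:
  fixes m :: "'a \<Rightarrow> 'a \<Rightarrow> 'a" (infixl \<open>\<cdot>\<close> 70)
    and f g :: "'a \<Rightarrow> 'b::field"
  assumes "semigroup m"
    and hom: "\<And>x y. \<sigma> (x \<cdot> y) = \<sigma> x \<cdot> \<sigma> y"
    and eq: "\<And>x y. g (x \<cdot> \<sigma> y) = g x * g y + f x * f y"
    and det: "g a * f b - f a * g b \<noteq> 0"
  shows "g (x \<cdot> y) = g (y \<cdot> x)"
proof -
  obtain p q where g_mult: "\<And>y z. g (y \<cdot> z) = g y * g z + p y * f z"
    and f_mult: "\<And>y z. f (y \<cdot> z) = f y * g z + q y * f z"
    and f_right: "\<And>x y. f (x \<cdot> \<sigma> y) = p y * g x + q y * f x"
    using addition_law_matrix[of m \<sigma> g f a b, OF assms] by blast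
  have "p x * p y = f x * f y" for x y
  proof -
    have "(p x * p y - f x * f y) * g z + (g x * f y + p x * q y - g y * p x - f y * q x) * f z = 0"
      for z
    proof -
      have "g (x \<cdot> (z \<cdot> \<sigma> y)) = g (x \<cdot> z \<cdot> \<sigma> y)"
        by (simp add: semigroup.assoc[OF \<open>semigroup m\<close>])
      then have "g x * (g z * g y + f z * f y) + p x * (p y * g z + q y * f z)
          = (g x * g z + p x * f z) * g y + (f x * g z + q x * f z) * f y"
        by (simp only: g_mult[of x "z \<cdot> \<sigma> y"] eq f_right) (simp only: g_mult f_mult)
      then show ?thesis by (simp add: algebra_simps)
    qed
    from linear_form_eq_0(1)[of g a f b, OF det this] show ?thesis by simp
  qed
  then have "p x * f y = p y * f x" by (rule mult_commute_if_same_products)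
  then show ?thesis by (simp add: g_mult mult.commute)
qed

lemma addition_law_solution_central:
  fixes m :: "'a \<Rightarrow> 'a \<Rightarrow> 'a" (infixl \<open>\<cdot>\<close> 70)
    and f g :: "'a \<Rightarrow> 'b::field"
  assumes "semigroup m"
    and hom: "\<And>x y. \<sigma> (x \<cdot> y) = \<sigma> x \<cdot> \<sigma> y" and "surj \<sigma>"
    and eq: "\<And>x y. g (x \<cdot> \<sigma> y) = g x * g y + f x * f y"
  shows "g (x \<cdot> y) = g (y \<cdot> x)"
proof (cases "\<forall>a. g a = 0")
  case True
  then show ?thesis by simp
next
  case False
  then obtain a where "g a \<noteq> 0" by blast
  then consider c where "\<And>x. f x = c * g x" | b where "g a * f b - f a * g b \<noteq> 0"
    using proportional_or_determinant[of g a f] by blast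
  then show ?thesis
  proof cases
    case 1
    then have "g (x \<cdot> \<sigma> y) = (1 + c * c) * g x * g y" for x y
      by (simp add: eq algebra_simps)
    then show ?thesis
      by (rule central_if_proportional[of m \<sigma>, OF assms(1-3)])
  next
    case 2
    show ?thesis by (rule central_if_independent[of m \<sigma> g f, OF assms(1) hom eq 2])
  qed
qed

section \<open>Equivalence of the two equations\<close>

theorem proposition3p4:
  fixes \<sigma> :: "'s::semigroup_mult \<Rightarrow> 's"
  assumes "semigroup_automorphism \<sigma>"
  shows "{(g :: 's \<Rightarrow> complex, f :: 's \<Rightarrow> complex).
            \<forall>x y. g (x * \<sigma> y) = g x * g y + f x * f y}
       = {(g :: 's \<Rightarrow> complex, f :: 's \<Rightarrow> complex).
            \<forall>x y. g (\<sigma> y * x) = g x * g y + f x * f y}"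
proof -
  have hom: "\<sigma> (x * y) = \<sigma> x * \<sigma> y" for x y
    using assms by (simp add: semigroup_automorphism_def)
  have surj: "surj \<sigma>"
    using assms by (simp add: semigroup_automorphism_def bij_is_surj)
  have op: "semigroup (\<lambda>x y :: 's. y * x)"
    by unfold_locales (simp add: mult.assoc)
  have "(\<forall>x y. g (x * \<sigma> y) = g x * g y + f x * f y)
      \<longleftrightarrow> (\<forall>x y. g (\<sigma> y * x) = g x * g y + f x * f y)" (is "?L \<longleftrightarrow> ?R")
    for g f :: "'s \<Rightarrow> complex"
  proof
    assume L: ?L
    have "g (x * y) = g (y * x)" for x y
      using addition_law_solution_central[OF mult.semigroup_axioms hom surj] L by blast
    with L show ?R by metis
  next
    assume R: ?R
    have "g (y * x) = g (x * y)" for x y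
      using addition_law_solution_central[OF op hom surj] R by blast
    with R show ?L by metis
  qed
  then show ?thesis by simp
qed

end
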